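(* For every integer $K\ge 2$, $$C(K,K+1,K)\;\ge\;\frac{2}{K+1}\;>\;C_\perp(K,K+1,K),$$ where $C(K,N,T)$ is the capacity of the $(K,N,T)$ MDS-PIR system (joint MDS storage coding of the messages allowed) and $C_\perp(K,N,T)$ is its capacity when the storage code is restricted to separate MDS coding of the messages.
   Context: Let $K,N,T$ be positive integers with $T\le N$. There are $K$ mutually independent messages $W^1,\dots,W^K$, each uniformly distributed over $\mathcal{X}^L$, where $\mathcal{X}$ is a finite alphabet with $|\mathcal{X}|\ge 2$ and $L\ge1$; there is an integer $M$ with $LK=MT$. A $(K,N,T)$ MDS-PIR code (for some choice of $\mathcal{X},L,M$) consists of: 1. storage encoding functions $\Phi_n:\mathcal{X}^{LK}\to\mathcal{X}^{M}$, $n\in\{1,\dots,N\}$; database $n$ stores $\Phi_n(W^{1:K})$; 2. for each $\mathcal{T}\subseteq\{1,\dots,N\}$ with $|\mathcal{T}|=T$, a recovery function $\Psi_{\mathcal{T}}:\mathcal{X}^{LK}\to\mathcal{X}^{LK}$ applied to the contents of the databases in $\mathcal{T}$; 3. a random key $\mathsf{F}$ taking values in a set $\mathcal{F}$, independent of the messages, and query functions $\phi_n:\{1,\dots,K\}\times\mathcal{F}\to\mathcal{Q}_n$; to retrieve $W^{k}$ the user sends $Q_n^{[k]}=\phi_n(k,\mathsf{F})$ to database $n$; 4. answer length functions $\ell_n:\mathcal{Q}_n\to\{0,1,2,\dots\}$ (the length depends only on the query); 5. answer functions: on query $q_n\in\mathcal{Q}_n$, database $n$ returns an answer $A_n^{[k]}\in\mathcal{A}_n^{\ell_n(q_n)}$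 that is a function of its stored content in $\mathcal{X}^M$ and of $q_n$, where $\mathcal{A}_n$ is a finite field; 6. a reconstruction function $\psi$ producing $\hat W^{k}=\psi(A_{1:N}^{[k]},k,\mathsf{F})\in\mathcal{X}^L$. These must satisfy: (MDS recoverability) for every $\mathcal{T}$ with $|\mathcal{T}|=T$, $\Psi_{\mathcal{T}}$ applied to $(\Phi_n(W^{1:K}))_{n\in\mathcal{T}}$ equals $W^{1:K}$; (retrieval correctness) $\hat W^{k}=W^{k}$ for every $k$; (privacy) $\Pr(Q_n^{[k]}=q)=\Pr(Q_n^{[k']}=q)$ for all $k,k'\in\{1,\dots,K\}$, all $n$ and all $q\in\mathcal{Q}_n$. The retrieval rate of the code is $R=\dfrac{L\log|\mathcal{X}|}{\sum_{n=1}^N\mathbb{E}(\ell_n)\log|\mathcal{A}_n|}$, where $\mathbb{E}(\ell_n)$ is the expected answer length of database $n$ (by privacy it does not depend on the desired index). The capacity $C(K,N,T)$ is the supremum of $R$ over all $(K,N,T)$ MDS-PIR codes. The storage code is separate if $\Phi_n=(\Phi_n^1,\dots,\Phi_n^K)$ with $\Phi_n^k:\mathcal{X}^L\to\mathcal{X}^{M/K}$ applied to $W^k$ only, and correspondingly $\Psi_{\mathcal{T}}=(\Psi_{\mathcal{T}}^1,\dots,\Psi_{\mathcal{T}}^K)$ with $\Psi_{\mathcal{T}}^k:\mathcal{X}^L\to\mathcal{X}^L$ decoding $W^k$ from the parts $\Phi_n^k(W^k)$, $n\in\mathcal{T}$. $C_\perp(K,N,T)$ is the supremum of $R$ over $(K,N,T)$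 MDS-PIR codes with separate storage code. It is a known result (Banawan–Ulukus), which may be taken as given, that $$C_\perp(K,N,T)=\left(1+\frac{T}{N}+\cdots+\left(\frac{T}{N}\right)^{K-1}\right)^{-1}.$$ *)

theory Defs
  imports "HOL-Algebra.Ring" "HOL-Probability.Probability_Mass_Function"
begin

definition words :: "'x set \<Rightarrow> nat \<Rightarrow> 'x list set" where
  "words X m = {xs. set xs \<subseteq> X \<and> length xs = m}"

text \<open>
  A tuple of \<open>K\<close> messages is a function on \<open>{1..K}\<close> (databases are likewise numbered \<open>1..N\<close>);
  the space \<open>X\<^sup>L\<^sup>K\<close> is \<open>message_tuples X L K\<close>.
\<close>

definition message_tuples :: "'x set \<Rightarrow> nat \<Rightarrow> nat \<Rightarrow> (nat \<Rightarrow> 'x list) set" where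
  "message_tuples X L K = {1..K} \<rightarrow>\<^sub>E words X L"

text \<open>
  The key is a discrete random variable, so its law is a probability mass function. The type
  \<open>'f\<close> plays the role of the set of key values. Recovery and reconstruction functions receive
  the family of database contents (answers) restricted to the databases in question.
\<close>

record ('x, 'f, 'q, 'a) pir_code =
  alphabet :: "'x set"
  msg_len :: nat
  store_len :: nat
  store :: "nat \<Rightarrow> (nat \<Rightarrow> 'x list) \<Rightarrow> 'x list"
  recover :: "nat set \<Rightarrow> (nat \<Rightarrow> 'x list) \<Rightarrow> nat \<Rightarrow> 'x list"
  key :: "'f pmf"
  queries :: "nat \<Rightarrow> 'q set"
  query :: "nat \<Rightarrow> nat \<Rightarrow> 'f \<Rightarrow> 'q"
  ans_len :: "nat \<Rightarrow> 'q \<Rightarrow> nat"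
  ans_field :: "nat \<Rightarrow> 'a ring"
  answer :: "nat \<Rightarrow> 'x list \<Rightarrow> 'q \<Rightarrow> 'a list"
  reconstruct :: "(nat \<Rightarrow> 'a list) \<Rightarrow> nat \<Rightarrow> 'f \<Rightarrow> 'x list"

definition well_typed_code :: "nat \<Rightarrow> nat \<Rightarrow> nat \<Rightarrow> ('x, 'f, 'q, 'a) pir_code \<Rightarrow> bool" where
  "well_typed_code K N T c \<longleftrightarrow>
    finite (alphabet c) \<and> card (alphabet c) \<ge> 2 \<and> msg_len c \<ge> 1 \<and>
    msg_len c * K = store_len c * T \<and>
    (\<forall>n\<in>{1..N}. store c n \<in>
       message_tuples (alphabet c) (msg_len c) K \<rightarrow> words (alphabet c) (store_len c)) \<and>
    (\<forall>S. S \<subseteq> {1..N} \<and> card S = T \<longrightarrow>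
       recover c S \<in> (S \<rightarrow>\<^sub>E words (alphabet c) (store_len c))
         \<rightarrow> message_tuples (alphabet c) (msg_len c) K) \<and>
    (\<forall>n\<in>{1..N}. \<forall>k\<in>{1..K}. \<forall>f. query c n k f \<in> queries c n) \<and>
    (\<forall>n\<in>{1..N}. field (ans_field c n) \<and> finite (carrier (ans_field c n))) \<and>
    (\<forall>n\<in>{1..N}. \<forall>s\<in>words (alphabet c) (store_len c). \<forall>q\<in>queries c n.
       answer c n s q \<in> words (carrier (ans_field c n)) (ans_len c n q)) \<and>
    (\<forall>a\<in>(\<Pi>\<^sub>E n\<in>{1..N}. lists (carrier (ans_field c n))). \<forall>k\<in>{1..K}. \<forall>f.
       reconstruct c a k f \<in> words (alphabet c) (msg_len c))"

definition mds_recoverable :: "nat \<Rightarrow> nat \<Rightarrow> nat \<Rightarrow> ('x, 'f, 'q, 'a) pir_code \<Rightarrow> bool" where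
  "mds_recoverable K N T c \<longleftrightarrow>
    (\<forall>S. S \<subseteq> {1..N} \<and> card S = T \<longrightarrow>
       (\<forall>w\<in>message_tuples (alphabet c) (msg_len c) K.
          recover c S (\<lambda>n\<in>S. store c n w) = w))"

text \<open>
  Joint law of the messages (independent and uniform, i.e. uniform on all tuples) and the key,
  which is independent of them.
\<close>

definition message_key_law ::
    "nat \<Rightarrow> ('x, 'f, 'q, 'a) pir_code \<Rightarrow> ((nat \<Rightarrow> 'x list) \<times> 'f) pmf" where
  "message_key_law K c =
    pair_pmf (pmf_of_set (message_tuples (alphabet c) (msg_len c) K)) (key c)"

definition retrieval_correct :: "nat \<Rightarrow> nat \<Rightarrow> ('x, 'f, 'q, 'a) pir_code \<Rightarrow> bool" where
  "retrieval_correct K N c \<longleftrightarrow>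
    (\<forall>k\<in>{1..K}. AE (w, f) in measure_pmf (message_key_law K c).
       reconstruct c (\<lambda>n\<in>{1..N}. answer c n (store c n w) (query c n k f)) k f = w k)"

definition query_private :: "nat \<Rightarrow> nat \<Rightarrow> ('x, 'f, 'q, 'a) pir_code \<Rightarrow> bool" where
  "query_private K N c \<longleftrightarrow>
    (\<forall>k\<in>{1..K}. \<forall>k'\<in>{1..K}. \<forall>n\<in>{1..N}. \<forall>q\<in>queries c n.
       measure_pmf.prob (key c) {f. query c n k f = q} =
       measure_pmf.prob (key c) {f. query c n k' f = q})"

definition mds_pir_code :: "nat \<Rightarrow> nat \<Rightarrow> nat \<Rightarrow> ('x, 'f, 'q, 'a) pir_code \<Rightarrow> bool" where
  "mds_pir_code K N T c \<longleftrightarrow>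
    well_typed_code K N T c \<and> mds_recoverable K N T c \<and>
    retrieval_correct K N c \<and> query_private K N c"

text \<open>
  Separate storage: the content \<open>X\<^sup>M\<close> consists of \<open>K\<close> consecutive blocks of length \<open>M / K\<close>, the
  \<open>k\<close>-th of which depends on the \<open>k\<close>-th message only, and recovery acts block by block.
\<close>

definition block :: "nat \<Rightarrow> nat \<Rightarrow> 'x list \<Rightarrow> 'x list" where
  "block m k xs = take m (drop ((k - 1) * m) xs)"

definition separate_storage :: "nat \<Rightarrow> nat \<Rightarrow> nat \<Rightarrow> ('x, 'f, 'q, 'a) pir_code \<Rightarrow> bool" where
  "separate_storage K N T c \<longleftrightarrow>
    K dvd store_len c \<and>
    (\<exists>\<Phi> \<Psi>.
      (\<forall>n\<in>{1..N}. \<forall>k\<in>{1..K}.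
         \<Phi> n k \<in> words (alphabet c) (msg_len c) \<rightarrow> words (alphabet c) (store_len c div K)) \<and>
      (\<forall>n\<in>{1..N}. \<forall>w\<in>message_tuples (alphabet c) (msg_len c) K.
         store c n w = concat (map (\<lambda>k. \<Phi> n k (w k)) [1..<K + 1])) \<and>
      (\<forall>S. S \<subseteq> {1..N} \<and> card S = T \<longrightarrow>
         (\<forall>k\<in>{1..K}. \<Psi> S k \<in> (S \<rightarrow>\<^sub>E words (alphabet c) (store_len c div K))
            \<rightarrow> words (alphabet c) (msg_len c)) \<and>
         (\<forall>s\<in>S \<rightarrow>\<^sub>E words (alphabet c) (store_len c).
            recover c S s = (\<lambda>k\<in>{1..K}. \<Psi> S k (\<lambda>n\<in>S. block (store_len c div K) k (s n))))))"

definition expected_length :: "('x, 'f, 'q, 'a) pir_code \<Rightarrow> nat \<Rightarrow> nat \<Rightarrow> ennreal" where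
  "expected_length c k n = (\<integral>\<^sup>+ f. of_nat (ans_len c n (query c n k f)) \<partial>measure_pmf (key c))"

lemma expected_length_index_irrelevant:
  fixes c :: "('x, 'f, 'q, 'a) pir_code"
  assumes c: "mds_pir_code K N T c" and k: "k \<in> {1..K}" "k' \<in> {1..K}" and n: "n \<in> {1..N}"
  shows "expected_length c k n = expected_length c k' n"
proof -
  have range: "query c n j f \<in> queries c n" if "j \<in> {1..K}" for j f
  proof -
    have "well_typed_code K N T c"
      using c by (simp only: mds_pir_code_def)
    then have "\<forall>n\<in>{1..N}. \<forall>k\<in>{1..K}. \<forall>f. query c n k f \<in> queries c n"
      unfolding well_typed_code_def by (elim conjE)
    then show ?thesis using n that by blast
  qed
  have "pmf (map_pmf (query c n k) (key c)) q = pmf (map_pmf (query c n k') (key c)) q" for q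
  proof (cases "q \<in> queries c n")
    case True
    have "query_private K N c"
      using c by (simp only: mds_pir_code_def)
    then have "measure_pmf.prob (key c) {f. query c n k f = q} =
        measure_pmf.prob (key c) {f. query c n k' f = q}"
      unfolding query_private_def using k n True by blast
    moreover have "query c n j -` {q} = {f. query c n j f = q}" for j
      by auto
    ultimately show ?thesis by (simp only: pmf_map)
  next
    case False
    then have "query c n k -` {q} = {}" "query c n k' -` {q} = {}"
      using range k by blast+
    then show ?thesis by (simp add: pmf_map)
  qed
  then have eq: "map_pmf (query c n k) (key c) = map_pmf (query c n k') (key c)"
    by (rule pmf_eqI)
  have "expected_length c j n =
      (\<integral>\<^sup>+ q. of_nat (ans_len c n q) \<partial>measure_pmf (map_pmf (query c n j) (key c)))" for j
    by (simp add: expected_length_def)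
  then show ?thesis by (simp only: eq)
qed

text \<open>
  The rate is evaluated at desired index 1, which is no restriction by the preceding lemma. Values
  in \<open>ennreal\<close> give rate 0 to a code of infinite expected length and make the suprema below
  unconditionally meaningful.
\<close>

definition rate :: "nat \<Rightarrow> ('x, 'f, 'q, 'a) pir_code \<Rightarrow> ennreal" where
  "rate N c =
    ennreal (real (msg_len c) * ln (real (card (alphabet c)))) /
    (\<Sum>n = 1..N. expected_length c 1 n * ennreal (ln (real (card (carrier (ans_field c n))))))"

text \<open>
  HOL cannot take a supremum over types. The alphabets and fields are finite and the key has
  countable support, so up to renaming every code lives on \<open>nat\<close>.
\<close>

type_synonym nat_pir_code = "(nat, nat, nat, nat) pir_code"

definition capacity :: "nat \<Rightarrow> nat \<Rightarrow> nat \<Rightarrow> ennreal" where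
  "capacity K N T = Sup {rate N c | c :: nat_pir_code. mds_pir_code K N T c}"

definition separate_capacity :: "nat \<Rightarrow> nat \<Rightarrow> nat \<Rightarrow> ennreal" where
  "separate_capacity K N T =
    Sup {rate N c | c :: nat_pir_code. mds_pir_code K N T c \<and> separate_storage K N T c}"

end

(* Take two-bit messages. Database n <= K stores W^n and database K + 1 stores the bitwise sum of
   all messages, which is an MDS code since the K + 1 contents sum to zero. To retrieve W^k, draw a
   random bit position f, ask database k for its bit at the other position, and every other
   database for its bit at position f. The first answer is one bit of W^k, the sum of the others
   is the other bit. Each database sees a uniform position, and K + 1 bits are downloaded for 2
   bits of message. The comparison with separate storage amounts to (1 + 1/K)^K > 2. *)
theory Submission imports Defs
begin

text \<open>The field of two elements, carried by \<open>nat\<close> because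
  \<open>nat_pir_code\<close> fixes that type. Products of bits are bits, so ordinary multiplication
  serves.\<close>

definition binary_field :: "nat ring" where
  "binary_field = \<lparr>carrier = {..<2}, monoid.mult = (*), one = 1, zero = 0, add = (\<lambda>x y. (x + y) mod 2)\<rparr>"

lemma field_binary_field: "field binary_field"
proof -
  have two: "x < 2 \<longleftrightarrow> x = 0 \<or> x = 1" for x :: nat
    by auto
  have "cring binary_field"
  proof (intro cringI abelian_groupI comm_monoidI)
    fix x assume "x \<in> carrier binary_field"
    \<comment> \<open>Characteristic two: each element is its own negative.\<close>
    then show "\<exists>y\<in>carrier binary_field. y \<oplus>\<^bsub>binary_field\<^esub> x = \<zero>\<^bsub>binary_field\<^esub>"
      by (intro bexI[of _ x]) (auto simp: binary_field_def two)
  qed (auto simp: binary_field_def two)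
  then show ?thesis
    by (rule cring.cring_fieldI2)
      (auto simp: binary_field_def two)
qed

text \<open>Well-typedness quantifies over all naturals \<open>f\<close>, not only the two keys in
  the support; the reduction keeps every query in range.\<close>

definition position :: "nat \<Rightarrow> nat \<Rightarrow> nat \<Rightarrow> nat" where
  "position n k f = (f + of_bool (n = k)) mod 2"

text \<open>Serves both as the encoder of database \<open>K + 1\<close> and as the decoder of a
  missing message.\<close>

definition parity_word :: "nat set \<Rightarrow> (nat \<Rightarrow> nat list) \<Rightarrow> nat list" where
  "parity_word A s = map (\<lambda>i. (\<Sum>n\<in>A. s n ! i) mod 2) [0..<2]"

definition parity_store :: "nat \<Rightarrow> nat \<Rightarrow> (nat \<Rightarrow> nat list) \<Rightarrow> nat list" where
  "parity_store K n w = (if n \<le> K then w n else parity_word {1..K} w)"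

text \<open>In \<open>reconstruct\<close> the outer reduction covers both branches, so the output is
  a bit word even for answer families that no database would send, such as empty lists.\<close>

definition parity_code :: "nat \<Rightarrow> nat_pir_code" where
  "parity_code K = \<lparr>
     alphabet = {..<2},
     msg_len = 2,
     store_len = 2,
     store = parity_store K,
     recover = (\<lambda>S s. \<lambda>k\<in>{1..K}. if k \<in> S then s k else parity_word S s),
     key = pmf_of_set {..<2},
     queries = (\<lambda>_. {..<2}),
     query = position,
     ans_len = (\<lambda>_ _. 1),
     ans_field = (\<lambda>_. binary_field),
     answer = (\<lambda>_ s q. [s ! q]),
     reconstruct = (\<lambda>a k f. map (\<lambda>i.
       (if i = position k k f then a k ! 0 else \<Sum>n\<in>{1..K + 1} - {k}. a n ! 0) mod 2) [0..<2])\<rparr>"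

lemma nth_in_words: "xs \<in> words X m \<Longrightarrow> i < m \<Longrightarrow> xs ! i \<in> X"
  by (auto simp: words_def)

lemma parity_word_in_words: "parity_word A s \<in> words {..<2} 2"
  by (auto simp: parity_word_def words_def)

lemma parity_store_in_words:
  assumes "w \<in> message_tuples {..<2} 2 K" and "n \<in> {1..K + 1}"
  shows "parity_store K n w \<in> words {..<2} 2"
  using assms parity_word_in_words
  by (auto simp: parity_store_def message_tuples_def PiE_iff)

text \<open>The \<open>K + 1\<close> contents sum to zero modulo 2, so each is the sum of the
  others. Both MDS recovery and retrieval rest on this.\<close>

lemma parity_store_nth_eq_sum_others:
  assumes w: "w \<in> message_tuples {..<2} 2 K" and k: "k \<in> {1..K}" and i: "i < 2"
  shows "(\<Sum>n\<in>{1..K + 1} - {k}. parity_store K n w ! i) mod 2 = w k ! i"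
proof -
  have "w k \<in> words {..<2} 2"
    using w k by (auto simp: message_tuples_def PiE_iff)
  then have bit: "w k ! i < 2"
    using i nth_in_words by blast
  define s where "s = (\<Sum>n\<in>{1..K} - {k}. w n ! i)"
  have "{1..K + 1} - {k} = insert (K + 1) ({1..K} - {k})"
    using k by auto
  then have "(\<Sum>n\<in>{1..K + 1} - {k}. parity_store K n w ! i) =
      parity_store K (K + 1) w ! i + (\<Sum>n\<in>{1..K} - {k}. parity_store K n w ! i)"
    by simp
  also have "(\<Sum>n\<in>{1..K} - {k}. parity_store K n w ! i) = s"
    unfolding s_def by (intro sum.cong) (auto simp: parity_store_def)
  also have "parity_store K (K + 1) w ! i = (w k ! i + s) mod 2"
    using i k by (simp add: parity_store_def parity_word_def s_def sum.remove)
  \<comment> \<open>The partial sum \<open>s\<close> now occurs twice and cancels modulo 2;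
    \<open>bit\<close> removes the last reduction.\<close>
  finally show ?thesis
    using bit by presburger
qed

text \<open>A choice of \<open>K\<close> databases omits exactly one, hence lacks at most one
  message, which is the sum of the chosen contents.\<close>

lemma mds_recoverable_parity_code:
  assumes "K \<ge> 1"
  shows "mds_recoverable K (K + 1) K (parity_code K)"
  unfolding mds_recoverable_def
proof (intro allI impI ballI)
  fix S w
  assume S: "S \<subseteq> {1..K + 1} \<and> card S = K"
    and "w \<in> message_tuples (alphabet (parity_code K)) (msg_len (parity_code K)) K"
  then have w: "w \<in> message_tuples {..<2} 2 K"
    by (simp add: parity_code_def)
  show "recover (parity_code K) S (\<lambda>n\<in>S. store (parity_code K) n w) = w"
  proof
    fix k
    consider "k \<notin> {1..K}" | "k \<in> {1..K}" "k \<in> S" | "k \<in> {1..K}" "k \<notin> S"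
      by blast
    then show "recover (parity_code K) S (\<lambda>n\<in>S. store (parity_code K) n w) k = w k"
    proof cases
      \<comment> \<open>Off the index set both sides are \<open>undefined\<close>.\<close>
      case 1
      then show ?thesis
        using w by (auto simp: parity_code_def message_tuples_def PiE_iff extensional_def)
    next
      case 2
      then show ?thesis
        by (simp add: parity_code_def parity_store_def)
    next
      case 3
      then have "S \<subseteq> {1..K + 1} - {k}"
        using S by blast
      moreover have "card S = card ({1..K + 1} - {k})"
        using S 3 by simp
      \<comment> \<open>By cardinality, a set that omits \<open>k\<close> contains every other
        database, the parity database included.\<close>
      ultimately have S_eq: "S = {1..K + 1} - {k}"
        by (intro card_subset_eq) auto
      have len: "length (w k) = 2"
        using w 3 by (auto simp: message_tuples_def PiE_iff words_def)
      have "parity_word S (\<lambda>n\<in>S. parity_store K n w) = w k"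
      proof (rule nth_equalityI)
        fix i assume "i < length (parity_word S (\<lambda>n\<in>S. parity_store K n w))"
        then have i: "i < 2"
          by (simp add: parity_word_def)
        then show "parity_word S (\<lambda>n\<in>S. parity_store K n w) ! i = w k ! i"
          using parity_store_nth_eq_sum_others[OF w 3(1) i]
          by (simp add: parity_word_def S_eq)
      qed (simp add: parity_word_def len)
      then show ?thesis
        using 3 by (simp add: parity_code_def)
    qed
  qed
qed

text \<open>Decoding succeeds for every message tuple and every key, so the almost sure claim only
  needs the support of the message law.\<close>

lemma retrieval_correct_parity_code: "retrieval_correct K (K + 1) (parity_code K)"
  unfolding retrieval_correct_def
proof (intro ballI)
  fix k assume k: "k \<in> {1..K}"
  let ?c = "parity_code K"
  let ?M = "message_tuples {..<2} 2 K :: (nat \<Rightarrow> nat list) set"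
  have decode: "reconstruct ?c (\<lambda>n\<in>{1..K + 1}. answer ?c n (store ?c n w) (query ?c n k f)) k f = w k"
    if w: "w \<in> ?M" for w f
  proof -
    have wk: "w k \<in> words {..<2} 2"
      using w k by (auto simp: message_tuples_def PiE_iff)
    have bit: "w k ! i < 2" if "i < 2" for i
      using nth_in_words[OF wk that] by simp
    have others: "(\<Sum>n\<in>{1..K + 1} - {k}. parity_store K n w ! position n k f) mod 2 = w k ! i"
      if i: "i < 2" "i \<noteq> position k k f" for i
    proof -
      \<comment> \<open>With two positions, the one not asked of database \<open>k\<close> is the
        one asked of all the others, so their answers add up in a single coordinate.\<close>
      have "i = f mod 2"
        using i by (auto simp: position_def) presburger
      then have "(\<Sum>n\<in>{1..K + 1} - {k}. parity_store K n w ! position n k f) =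
          (\<Sum>n\<in>{1..K + 1} - {k}. parity_store K n w ! i)"
        by (intro sum.cong) (auto simp: position_def)
      then show ?thesis
        using parity_store_nth_eq_sum_others[OF w k i(1)] by simp
    qed
    have "position k k f < 2"
      by (simp add: position_def)
    then show ?thesis
      using k wk bit others
      by (intro nth_equalityI) (auto simp: parity_code_def words_def parity_store_def)
  qed
  \<comment> \<open>\<open>pmf_of_set\<close> has the intended support only for a finite nonempty
    set.\<close>
  have "finite ?M"
    unfolding message_tuples_def words_def by (intro finite_PiE finite_lists_length_eq) auto
  moreover have "?M \<noteq> {}"
    unfolding message_tuples_def using parity_word_in_words by (auto simp: PiE_eq_empty_iff)
  ultimately show "AE (w, f) in measure_pmf (message_key_law K ?c).
      reconstruct ?c (\<lambda>n\<in>{1..K + 1}. answer ?c n (store ?c n w) (query ?c n k f)) k f = w k"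
    using decode by (auto simp: AE_measure_pmf_iff message_key_law_def parity_code_def)
qed

lemma query_private_parity_code: "query_private K (K + 1) (parity_code K)"
proof -
  have half: "measure_pmf.prob (pmf_of_set {..<2}) {f. position n k f = q} = 1 / 2" if "q < 2" for n k q
  proof -
    \<comment> \<open>Adding a fixed bit is an involution modulo 2, so exactly one of the two keys
      produces \<open>q\<close>, whatever \<open>k\<close> is.\<close>
    have "{..<2} \<inter> {f. position n k f = q} = {(q + of_bool (n = k)) mod 2}"
      using that by (auto simp: position_def) presburger+
    then show ?thesis
      by (simp add: measure_pmf_of_set lessThan_empty_iff)
  qed
  show ?thesis
    by (auto simp: query_private_def parity_code_def half)
qed

lemma mds_pir_code_parity_code:
  assumes "K \<ge> 1"
  shows "mds_pir_code K (K + 1) K (parity_code K)"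
proof -
  have "well_typed_code K (K + 1) K (parity_code K)"
    unfolding well_typed_code_def
    using parity_store_in_words[of _ K] parity_word_in_words field_binary_field
    by (auto simp: parity_code_def binary_field_def position_def message_tuples_def PiE_iff
        words_def subset_iff)
  then show ?thesis
    using assms mds_recoverable_parity_code retrieval_correct_parity_code query_private_parity_code
    by (simp add: mds_pir_code_def)
qed

text \<open>Two message bits against \<open>K + 1\<close> answers of one bit each; the factor
  \<open>ln 2\<close> cancels.\<close>

lemma rate_parity_code: "rate (K + 1) (parity_code K) = ennreal (2 / (real K + 1))"
proof -
  have "rate (K + 1) (parity_code K) = ennreal (2 * ln 2) / (of_nat (K + 1) * ennreal (ln 2))"
    by (simp add: rate_def expected_length_def parity_code_def binary_field_def)
  also have "of_nat (K + 1) * ennreal (ln 2) = ennreal ((real K + 1) * ln 2)"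
    by (simp add: ennreal_mult ennreal_of_nat_eq_real_of_nat add.commute flip: ennreal_plus)
  also have "ennreal (2 * ln 2) / \<dots> = ennreal (2 / (real K + 1))"
    by (subst divide_ennreal) auto
  finally show ?thesis .
qed

text \<open>For \<open>r = K / (K + 1)\<close> the geometric sum is
  \<open>(1 - r ^ K) * (K + 1)\<close>. It exceeds \<open>(K + 1) / 2\<close> exactly when
  \<open>r ^ K < 1 / 2\<close>, and \<open>r\<close> is the reciprocal of
  \<open>1 + 1 / K\<close>.\<close>

lemma separate_rate_less:
  fixes K :: nat
  assumes "K \<ge> 2"
  shows "inverse (\<Sum>i<K. (real K / real (K + 1)) ^ i) < 2 / (real K + 1)"
proof -
  define r where "r = real K / real (K + 1)"
  have r: "0 < r" "r < 1" "1 - r = 1 / (real K + 1)"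
    using assms by (auto simp: r_def field_simps)
  have "2 < (1 + 1 / real K) ^ K"
  proof -
    \<comment> \<open>Bernoulli with exponent \<open>K\<close> gives only the weak bound 2.
      Splitting off one factor first gains \<open>m / K^2\<close>, which is positive because
      \<open>K \<ge> 2\<close>.\<close>
    obtain m where m: "K = Suc m" "m \<ge> 1"
      using assms by (cases K) auto
    have "1 + real m * (1 / real K) \<le> (1 + 1 / real K) ^ m"
      by (rule Bernoulli_inequality) (rule order_trans[of _ 0], auto)
    then have "(1 + 1 / real K) * (1 + real m * (1 / real K)) \<le> (1 + 1 / real K) ^ K"
      using m by (simp add: mult_left_mono)
    moreover have "(1 + 1 / real K) * (1 + real m * (1 / real K)) = 2 + real m / (real K * real K)"
      using m by (simp add: divide_simps) (simp add: algebra_simps)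
    moreover have "0 < real m / (real K * real K)"
      using m by simp
    ultimately show ?thesis
      by linarith
  qed
  moreover have "(1 + 1 / real K) * r = 1"
    using assms by (simp add: r_def divide_simps)
  then have "(1 + 1 / real K) ^ K * r ^ K = 1"
    by (simp flip: power_mult_distrib)
  ultimately have "2 * r ^ K < 1"
    using r by (metis mult_strict_right_mono zero_less_power)
  then have "1 / 2 * (real K + 1) < (1 - r ^ K) * (real K + 1)"
    by (intro mult_strict_right_mono) auto
  moreover have "(\<Sum>i<K. r ^ i) = (1 - r ^ K) * (real K + 1)"
    using r sum_gp_strict[of r K] by simp
  ultimately have "(real K + 1) / 2 < (\<Sum>i<K. r ^ i)"
    by simp
  then have "inverse (\<Sum>i<K. r ^ i) < inverse ((real K + 1) / 2)"
    by (intro less_imp_inverse_less) auto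
  then show ?thesis
    by (simp add: r_def)
qed

theorem mainTheorem2:
  fixes K :: nat
  assumes banawan_ulukus: "\<forall>K' N T :: nat. 1 \<le> K' \<and> 1 \<le> T \<and> T \<le> N \<longrightarrow>
      separate_capacity K' N T = ennreal (inverse (\<Sum>i<K'. (real T / real N) ^ i))"
    and "K \<ge> 2"
  shows "capacity K (K + 1) K \<ge> ennreal (2 / (real K + 1)) \<and>
         ennreal (2 / (real K + 1)) > separate_capacity K (K + 1) K"
proof
  have "rate (K + 1) (parity_code K) \<le> capacity K (K + 1) K"
    unfolding capacity_def using mds_pir_code_parity_code[of K] \<open>K \<ge> 2\<close>
    by (intro Sup_upper) auto
  then show "capacity K (K + 1) K \<ge> ennreal (2 / (real K + 1))"
    by (simp only: rate_parity_code)
next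
  have "separate_capacity K (K + 1) K = ennreal (inverse (\<Sum>i<K. (real K / real (K + 1)) ^ i))"
    using banawan_ulukus \<open>K \<ge> 2\<close> by simp
  \<comment> \<open>Strict order passes from reals to \<open>ennreal\<close> once the smaller side
    is nonnegative, whence \<open>sum_nonneg\<close>.\<close>
  then show "ennreal (2 / (real K + 1)) > separate_capacity K (K + 1) K"
    using separate_rate_less[OF \<open>K \<ge> 2\<close>] by (simp add: ennreal_less_iff sum_nonneg)
qed

end
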